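(* Let $q\ge 5$ be a fixed odd integer. For positive integers $n$, the minimum redundancy $r_{\rm CPB}(n,q)$ of charge and polarity balanced codes of length $n$ over ${\cal A}_q$ satisfies $$r_{\rm CPB}(n,q)=n-\log_q M_{\rm CPB}(n,q)\approx \log_q n+\log_q\left(\pi\sqrt{\frac{(q^2-1)(q-1)(q-3)}{12q^2}}\right),$$ where $\approx$ means that the difference of the two sides tends to $0$ as $n\to\infty$.
   Context: For an integer $q\ge 2$, ${\cal A}_q=\{-q+1,-q+3,-q+5,\ldots,q-3,q-1\}$. A sequence ${\bf x}=(x_1,\ldots,x_n)\in({\cal A}_q)^n$ is charge-balanced (CB) if $\sum_{i=1}^n x_i=0$, polarity-balanced (PB) if $|\{i:x_i>0\}|=|\{i:x_i<0\}|$, and charge and polarity balanced (CPB) if it is both CB and PB. $M_{\rm CPB}(n,q)$ is the number of CPB sequences in $({\cal A}_q)^n$. A code of length $n$ is a set of sequences of length $n$; it is CPB if all its codewords are CPB. The redundancy of a $q$-ary code of length $n$ and size $M$ is $n-\log_q M$, and $r_{\rm CPB}(n,q)$ is the minimum redundancy among (nonempty) CPB codes of length $n$ over ${\cal A}_q$. *)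

theory Defs
  imports Complex_Main
begin

definition alphabet :: "nat \<Rightarrow> int set" where
  "alphabet q = (\<lambda>k. - int q + 1 + 2 * int k) ` {..<q}"

definition words :: "nat \<Rightarrow> nat \<Rightarrow> int list set" where
  "words n q = {x. length x = n \<and> set x \<subseteq> alphabet q}"

definition charge_balanced :: "int list \<Rightarrow> bool" where
  "charge_balanced x \<longleftrightarrow> (\<Sum>i<length x. x ! i) = 0"

definition polarity_balanced :: "int list \<Rightarrow> bool" where
  "polarity_balanced x \<longleftrightarrow>
     card {i. i < length x \<and> x ! i > 0} = card {i. i < length x \<and> x ! i < 0}"

definition CPB :: "int list \<Rightarrow> bool" where
  "CPB x \<longleftrightarrow> charge_balanced x \<and> polarity_balanced x"

definition M_CPB :: "nat \<Rightarrow> nat \<Rightarrow> nat" where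
  "M_CPB n q = card {x \<in> words n q. CPB x}"

definition is_CPB_code :: "nat \<Rightarrow> nat \<Rightarrow> int list set \<Rightarrow> bool" where
  "is_CPB_code n q C \<longleftrightarrow> C \<subseteq> words n q \<and> (\<forall>x\<in>C. CPB x)"

definition redundancy :: "nat \<Rightarrow> nat \<Rightarrow> int list set \<Rightarrow> real" where
  "redundancy n q C = real n - log (real q) (real (card C))"

(* words n q is finite, so Min ranges over a finite set; for odd q that set is
   nonempty, because the all-zero word is CPB. *)
definition r_CPB :: "nat \<Rightarrow> nat \<Rightarrow> real" where
  "r_CPB n q = Min (redundancy n q ` {C. is_CPB_code n q C \<and> C \<noteq> {}})"

end

theory Submission
  imports Defs "HOL-Probability.Distributions" "HOL-Real_Asymp.Real_Asymp"
begin

text \<open>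
  A uniformly random word is a random walk in the plane whose steps record the charge and the
  polarity of a letter, and the CPB words are the walks that return to the origin; the claim is the
  local central limit theorem for this walk. By Fourier inversion the return probability is
  \<open>1 / (2 \<pi>)\<^sup>2\<close> times the integral over \<open>[-\<pi>, \<pi>]\<^sup>2\<close> of the \<open>n\<close>-th power of the characteristic function
  \<open>\<phi>\<close> of one step. After rescaling by \<open>sqrt n\<close> the integrand tends to a Gaussian. Choosing lattice
  coordinates in which two letters are the standard basis vectors makes \<open>\<phi>\<close> contain the terms
  \<open>cos x + cos y\<close>, which gives the bound \<open>\<bar>\<phi> (x, y)\<bar> \<le> exp (- c (x\<^sup>2 + y\<^sup>2))\<close> on the whole square, so
  dominated convergence applies. The constant comes from the covariance determinant of one step.
\<close>

section \<open>Elementary estimates: a quadratic gap for the cosine, and powers of numbers near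
  1\<close>

text \<open>Since \<open>1 - cos x = 2 * (sin (x/2))\<^sup>2\<close>, a linear lower bound for the
  sine suffices. With \<open>y = \<bar>x\<bar> / 2 \<le> 2\<close>, the cubic Taylor bound gives
  \<open>sin y \<ge> y - y ^ 3 / 6 \<ge> y / 3\<close>, whence the constant 18.\<close>

lemma one_minus_cos_ge:
  fixes x :: real
  assumes "\<bar>x\<bar> \<le> pi"
  shows "1 - cos x \<ge> x\<^sup>2 / 18"
proof -
  define y where "y = \<bar>x\<bar> / 2"
  have y: "0 \<le> y" "y \<le> 2"
    using assms pi_less_4 by (auto simp: y_def)
  have "\<bar>sin y - (\<Sum>m<3. sin_coeff m * y ^ m)\<bar> \<le> inverse (fact 3) * \<bar>y\<bar> ^ 3"
    by (rule Maclaurin_sin_bound)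
  then have "\<bar>sin y - y\<bar> \<le> y ^ 3 / 6"
    using y by (simp add: sin_coeff_def eval_nat_numeral)
  then have "sin y \<ge> y - y ^ 3 / 6"
    by linarith
  moreover have "y ^ 3 \<le> 4 * y"
    using mult_mono[of y 2 y 2] y by (simp add: power3_eq_cube mult_right_mono)
  ultimately have "y / 3 \<le> sin y"
    by simp
  then have "(y / 3)\<^sup>2 \<le> (sin y)\<^sup>2"
    using y by (intro power_mono) auto
  moreover have "cos x = 1 - 2 * (sin y)\<^sup>2"
    using cos_double_sin[of y] by (simp add: y_def)
  ultimately show ?thesis
    by (simp add: y_def power_divide)
qed

text \<open>Convergence of \<open>n * w n\<close> forces \<open>w n\<close> to 0, so the error of
  \<open>n * ln (1 + w n)\<close> against \<open>n * w n\<close>, of order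
  \<open>n * (w n)\<^sup>2\<close>, vanishes.\<close>

lemma tendsto_power_exp:
  fixes w :: "nat \<Rightarrow> real"
  assumes "(\<lambda>n. real n * w n) \<longlonglongrightarrow> z"
  shows "(\<lambda>n. (1 + w n) ^ n) \<longlonglongrightarrow> exp z"
proof -
  have inv: "(\<lambda>n. inverse (real n)) \<longlonglongrightarrow> 0"
    by real_asymp
  have "(\<lambda>n. inverse (real n) * (real n * w n)) \<longlonglongrightarrow> 0 * z"
    by (intro tendsto_mult inv assms)
  moreover have "\<forall>\<^sub>F n in sequentially. inverse (real n) * (real n * w n) = w n"
    using eventually_gt_at_top[of 0] by eventually_elim simp
  ultimately have w0: "w \<longlonglongrightarrow> 0"
    using Lim_transform_eventually by fastforce
  \<comment> \<open>The threshold 1/2 admits the quadratic bound on the logarithm and keeps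
    \<open>1 + w n\<close> positive, so that the power equals the exponential at the end.\<close>
  have small: "\<forall>\<^sub>F n in sequentially. \<bar>w n\<bar> < 1/2"
    using tendstoD[OF w0, of "1/2"] by simp
  have "(\<lambda>n. real n * ln (1 + w n) - real n * w n) \<longlonglongrightarrow> 0"
  proof (rule Lim_null_comparison)
    show "\<forall>\<^sub>F n in sequentially.
        norm (real n * ln (1 + w n) - real n * w n) \<le> 2 * (\<bar>real n * w n\<bar> * \<bar>w n\<bar>)"
      using small
    proof eventually_elim
      case (elim n)
      have "norm (real n * ln (1 + w n) - real n * w n) = real n * \<bar>ln (1 + w n) - w n\<bar>"
        by (simp add: abs_mult flip: right_diff_distrib)
      also have "\<dots> \<le> real n * (2 * (w n)\<^sup>2)"
        using elim by (intro mult_left_mono abs_ln_one_plus_x_minus_x_bound) auto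
      also have "\<dots> = 2 * (\<bar>real n * w n\<bar> * \<bar>w n\<bar>)"
        by (simp add: abs_mult power2_eq_square)
      finally show ?case .
    qed
    have "(\<lambda>n. 2 * (\<bar>real n * w n\<bar> * \<bar>w n\<bar>)) \<longlonglongrightarrow> 2 * (\<bar>z\<bar> * \<bar>0\<bar>)"
      by (intro tendsto_intros assms w0)
    then show "(\<lambda>n. 2 * (\<bar>real n * w n\<bar> * \<bar>w n\<bar>)) \<longlonglongrightarrow> 0"
      by simp
  qed
  from tendsto_add[OF this assms] have "(\<lambda>n. real n * ln (1 + w n)) \<longlonglongrightarrow> z"
    by simp
  then have "(\<lambda>n. exp (real n * ln (1 + w n))) \<longlonglongrightarrow> exp z"
    by (rule tendsto_exp)
  then show ?thesis
  proof (rule Lim_transform_eventually)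
    show "\<forall>\<^sub>F n in sequentially. exp (real n * ln (1 + w n)) = (1 + w n) ^ n"
      using small by eventually_elim (simp add: exp_of_nat_mult)
  qed
qed

lemma cos_second_order:
  fixes t :: real
  shows "(\<lambda>n. real n * (cos (t / sqrt (real n)) - 1)) \<longlonglongrightarrow> - t\<^sup>2 / 2"
proof (cases "t = 0")
  case False
  then have "(\<lambda>n. real n * (cos (t / sqrt (real n)) - 1)) \<longlonglongrightarrow> - (t * t / 2)"
    by real_asymp
  then show ?thesis
    by (simp add: power2_eq_square)
qed simp

section \<open>Gaussian integrals in one and two dimensions\<close>

text \<open>Up to a factor this is a normal density with mean \<open>- b\<close> and variance
  \<open>1 / a\<close>. The shift \<open>b\<close> serves to complete the square below.\<close>

lemma gaussian_integral_1d:
  fixes a b :: real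
  assumes "a > 0"
  shows "integrable lborel (\<lambda>x. exp (- a * (x + b)\<^sup>2 / 2))"
    and "(\<integral>x. exp (- a * (x + b)\<^sup>2 / 2) \<partial>lborel) = sqrt (2 * pi / a)"
proof -
  have *: "exp (- a * (x + b)\<^sup>2 / 2) = sqrt (2 * pi / a) * normal_density (- b) (1 / sqrt a) x" for x
    using assms
    by (simp add: normal_density_def power_divide real_sqrt_divide real_sqrt_mult)
  show "integrable lborel (\<lambda>x. exp (- a * (x + b)\<^sup>2 / 2))"
    unfolding * using assms by simp
  show "(\<integral>x. exp (- a * (x + b)\<^sup>2 / 2) \<partial>lborel) = sqrt (2 * pi / a)"
    unfolding * using assms by simp
qed

lemma integrable_pair_mult:
  fixes f g :: "real \<Rightarrow> real"
  assumes f: "integrable lborel f" and g: "integrable lborel g"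
  shows "integrable (lborel \<Otimes>\<^sub>M lborel) (\<lambda>(x, y). f x * g y)"
proof (rule lborel_pair.Fubini_integrable)
  have [measurable]: "f \<in> borel_measurable borel" "g \<in> borel_measurable borel"
    using f g by (simp_all add: integrable_iff_bounded)
  show "(\<lambda>(x, y). f x * g y) \<in> borel_measurable (lborel \<Otimes>\<^sub>M lborel)"
    by measurable
  show "integrable lborel (\<lambda>x. \<integral>y. norm (case (x, y) of (x, y) \<Rightarrow> f x * g y) \<partial>lborel)"
    using f by (simp add: abs_mult)
  show "AE x in lborel. integrable lborel (\<lambda>y. case (x, y) of (x, y) \<Rightarrow> f x * g y)"
    using g by simp
qed

lemma integral_pair_mult:
  fixes f g :: "real \<Rightarrow> real"
  assumes f: "integrable lborel f" and g: "integrable lborel g"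
  shows "(\<integral>(x, y). f x * g y \<partial>(lborel \<Otimes>\<^sub>M lborel)) = (\<integral>x. f x \<partial>lborel) * (\<integral>y. g y \<partial>lborel)"
  using lborel_pair.integral_fst[OF integrable_pair_mult[OF assms]] by simp

text \<open>Completing the square in \<open>x\<close> leaves the Schur complement \<open>D\<close>
  as coefficient of \<open>y\<^sup>2\<close>; the inner integral does not depend on
  \<open>y\<close>. Integrability is assumed here because dominated convergence supplies it in the
  application.\<close>

lemma gaussian_integral_2d:
  fixes A B C :: real
  assumes "A > 0" and det: "A * C - B\<^sup>2 > 0"
    and int: "integrable (lborel \<Otimes>\<^sub>M lborel) (\<lambda>(x, y). exp (- (A * x\<^sup>2 + 2 * B * x * y + C * y\<^sup>2) / 2))"
  shows "(\<integral>(x, y). exp (- (A * x\<^sup>2 + 2 * B * x * y + C * y\<^sup>2) / 2) \<partial>(lborel \<Otimes>\<^sub>M lborel))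
    = 2 * pi / sqrt (A * C - B\<^sup>2)"
proof -
  define D where "D = (A * C - B\<^sup>2) / A"
  have D: "D > 0"
    using assms by (simp add: D_def)
  have split: "exp (- (A * x\<^sup>2 + 2 * B * x * y + C * y\<^sup>2) / 2)
      = exp (- A * (x + B * y / A)\<^sup>2 / 2) * exp (- D * (y + 0)\<^sup>2 / 2)" for x y
  proof -
    have "A * x\<^sup>2 + 2 * B * x * y + C * y\<^sup>2 = A * (x + B * y / A)\<^sup>2 + D * (y + 0)\<^sup>2"
      using \<open>A > 0\<close> by (simp add: D_def field_simps power2_eq_square)
    then show ?thesis
      by (simp add: exp_add[symmetric] add_divide_distrib)
  qed
  have "(\<integral>(x, y). exp (- (A * x\<^sup>2 + 2 * B * x * y + C * y\<^sup>2) / 2) \<partial>(lborel \<Otimes>\<^sub>M lborel))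
      = (\<integral>y. (\<integral>x. exp (- (A * x\<^sup>2 + 2 * B * x * y + C * y\<^sup>2) / 2) \<partial>lborel) \<partial>lborel)"
    using lborel_pair.integral_snd[OF int] by simp
  also have "\<dots> = sqrt (2 * pi / A) * sqrt (2 * pi / D)"
    unfolding split using gaussian_integral_1d[OF \<open>A > 0\<close>] gaussian_integral_1d[OF D, of 0] by simp
  also have "\<dots> = sqrt ((2 * pi)\<^sup>2 / (A * C - B\<^sup>2))"
    unfolding real_sqrt_mult[symmetric]
    using \<open>A > 0\<close> by (simp add: D_def power2_eq_square)
  also have "\<dots> = 2 * pi / sqrt (A * C - B\<^sup>2)"
    by (simp only: real_sqrt_divide real_sqrt_abs) simp
  finally show ?thesis .
qed

section \<open>Orthogonality of characters on a rescaled period square\<close>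

lemma cos_int_scaled_integral:
  fixes k :: int and r :: real
  assumes "r > 0"
  shows "has_bochner_integral lborel
    (\<lambda>x. cos (real_of_int k * (x / r)) * indicator {- pi * r..pi * r} x) (if k = 0 then 2 * pi * r else 0)"
proof (cases "k = 0")
  case True
  have "has_bochner_integral lborel (\<lambda>x. 1 * indicator {- pi * r..pi * r} x) (pi * r - - pi * r)"
    using assms by (intro has_bochner_integral_FTC_Icc_real) (auto intro!: derivative_eq_intros)
  then show ?thesis
    using True by (simp add: mult_ac)
next
  case False
  have "has_bochner_integral lborel
      (\<lambda>x. cos (real_of_int k * (x / r)) * indicator {- pi * r..pi * r} x)
      (r / real_of_int k * sin (real_of_int k * ((pi * r) / r)) -
       r / real_of_int k * sin (real_of_int k * ((- pi * r) / r)))"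
    using assms False
    by (intro has_bochner_integral_FTC_Icc_real) (auto intro!: derivative_eq_intros)
  then show ?thesis
    using assms False sin_zero_iff_int2[of "real_of_int k * pi"] by auto
qed

lemma sin_int_scaled_integral:
  fixes k :: int and r :: real
  assumes "r > 0"
  shows "has_bochner_integral lborel
    (\<lambda>x. sin (real_of_int k * (x / r)) * indicator {- pi * r..pi * r} x) 0"
proof (cases "k = 0")
  case False
  have "has_bochner_integral lborel
      (\<lambda>x. sin (real_of_int k * (x / r)) * indicator {- pi * r..pi * r} x)
      (- r / real_of_int k * cos (real_of_int k * ((pi * r) / r)) -
       (- r / real_of_int k * cos (real_of_int k * ((- pi * r) / r))))"
    using assms False
    by (intro has_bochner_integral_FTC_Icc_real) (auto intro!: derivative_eq_intros)
  then show ?thesis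
    using assms by simp
qed (simp add: has_bochner_integral_zero)

text \<open>The addition formula splits the integrand into a product of cosines minus a product of
  sines. The sines integrate to 0, and the cosines survive only at frequency 0. The scale
  \<open>r\<close> will be \<open>sqrt n\<close>.\<close>

lemma cos_lattice_orthogonality:
  fixes u v :: int and r :: real
  assumes "r > 0"
  shows "has_bochner_integral (lborel \<Otimes>\<^sub>M lborel)
    (\<lambda>(x, y). cos (real_of_int u * (x / r) + real_of_int v * (y / r))
      * (indicator {- pi * r..pi * r} x * indicator {- pi * r..pi * r} y))
    (if u = 0 \<and> v = 0 then (2 * pi * r)\<^sup>2 else 0)"
proof -
  let ?I = "indicator {- pi * r..pi * r} :: real \<Rightarrow> real"
  let ?c = "\<lambda>k x. cos (real_of_int k * (x / r)) * ?I x"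
  let ?s = "\<lambda>k x. sin (real_of_int k * (x / r)) * ?I x"
  note c = cos_int_scaled_integral[OF assms, unfolded has_bochner_integral_iff]
  note s = sin_int_scaled_integral[OF assms, unfolded has_bochner_integral_iff]
  have C: "has_bochner_integral (lborel \<Otimes>\<^sub>M lborel) (\<lambda>(x, y). ?c u x * ?c v y)
      (if u = 0 \<and> v = 0 then (2 * pi * r)\<^sup>2 else 0)"
    unfolding has_bochner_integral_iff
  proof
    show "integrable (lborel \<Otimes>\<^sub>M lborel) (\<lambda>(x, y). ?c u x * ?c v y)"
      using c by (intro integrable_pair_mult) auto
    show "(\<integral>(x, y). ?c u x * ?c v y \<partial>(lborel \<Otimes>\<^sub>M lborel)) = (if u = 0 \<and> v = 0 then (2 * pi * r)\<^sup>2 else 0)"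
      using c[of u] c[of v] by (subst integral_pair_mult) (auto simp: power2_eq_square)
  qed
  have S: "has_bochner_integral (lborel \<Otimes>\<^sub>M lborel) (\<lambda>(x, y). ?s u x * ?s v y) 0"
    unfolding has_bochner_integral_iff
  proof
    show "integrable (lborel \<Otimes>\<^sub>M lborel) (\<lambda>(x, y). ?s u x * ?s v y)"
      using s by (intro integrable_pair_mult) auto
    show "(\<integral>(x, y). ?s u x * ?s v y \<partial>(lborel \<Otimes>\<^sub>M lborel)) = 0"
      using s[of u] s[of v] by (subst integral_pair_mult) auto
  qed
  show ?thesis
    using has_bochner_integral_diff[OF C S]
    by (simp add: cos_add case_prod_unfold algebra_simps)
qed

section \<open>Lattice coordinates and the characteristic function of one step\<close>

text \<open>
  A letter \<open>a = 2 y\<close> contributes the lattice vector \<open>(y, sgn y)\<close> to (half) the charge and the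
  polarity. The coordinates below differ from these by a unimodular change of basis that sends the
  letters \<open>2\<close> and \<open>4\<close> to the standard basis vectors.
\<close>

definition coord1 :: "int \<Rightarrow> int" where
  "coord1 a = 2 * sgn a - a div 2"

definition coord2 :: "int \<Rightarrow> int" where
  "coord2 a = a div 2 - sgn a"

text \<open>The characteristic function of a uniform letter for \<open>q = 2 * m + 1\<close>. It is
  real because letters come in pairs \<plusminus>2k with coordinates \<plusminus>(2 - k, k - 1); the
  letter 0 gives the summand 1.\<close>

definition charf :: "nat \<Rightarrow> real \<Rightarrow> real \<Rightarrow> real" where
  "charf m x y = (1 + 2 * (\<Sum>k=1..m. cos ((2 - real k) * x + (real k - 1) * y))) / (2 * real m + 1)"

lemma alphabet_odd_Suc:
  "alphabet (2 * Suc m + 1) =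
    insert (2 * int (Suc m)) (insert (- (2 * int (Suc m))) (alphabet (2 * m + 1)))"
proof -
  \<comment> \<open>The extreme indices \<open>2 * m + 2\<close> and 0 give the two new letters;
    shifting the inner indices by one compensates for the lower starting point.\<close>
  have "{..<2 * Suc m + 1} = insert (2 * m + 2) {..<Suc (2 * m + 1)}"
    by auto
  then have "{..<2 * Suc m + 1} = insert (2 * m + 2) (insert 0 (Suc ` {..<2 * m + 1}))"
    by (simp only: lessThan_Suc_eq_insert_0)
  then show ?thesis
    unfolding alphabet_def by (simp add: image_image algebra_simps insert_commute)
qed

lemma alphabet_odd_bounds:
  assumes "a \<in> alphabet (2 * m + 1)"
  shows "even a" and "\<bar>a\<bar> \<le> 2 * int m"
  using assms by (auto simp: alphabet_def)

lemma finite_alphabet [simp]: "finite (alphabet q)"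
  by (simp add: alphabet_def)

lemma sum_alphabet_odd:
  fixes f :: "int \<Rightarrow> 'a::comm_monoid_add"
  shows "(\<Sum>a\<in>alphabet (2 * m + 1). f a) = f 0 + (\<Sum>k=1..m. f (2 * int k) + f (- (2 * int k)))"
proof (induction m)
  case 0
  have "alphabet (2 * 0 + 1) = {0}"
    by (auto simp: alphabet_def)
  then show ?case by simp
next
  case (Suc m)
  have "2 * int (Suc m) \<notin> alphabet (2 * m + 1)" "- (2 * int (Suc m)) \<notin> alphabet (2 * m + 1)"
    using alphabet_odd_bounds(2)[of _ m] by force+
  then show ?case
    unfolding alphabet_odd_Suc using Suc by (simp add: add_ac del: of_nat_Suc)
qed

lemma words_eq: "words n q = {x. set x \<subseteq> alphabet q \<and> length x = n}"
  by (auto simp: words_def)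

lemma finite_words [simp]: "finite (words n q)"
  by (simp add: words_eq finite_lists_length_eq)

text \<open>This is multiplicativity of characteristic functions for independent letters, in real
  form: when a letter is appended, the sine part of the addition formula sums to 0 over that
  letter.\<close>

lemma sum_lists_cos:
  fixes \<alpha> :: "'a \<Rightarrow> real"
  assumes "finite S" and "(\<Sum>a\<in>S. sin (\<alpha> a)) = 0"
  shows "(\<Sum>w | set w \<subseteq> S \<and> length w = n. cos (sum_list (map \<alpha> w))) = (\<Sum>a\<in>S. cos (\<alpha> a)) ^ n"
proof (induction n)
  case 0
  have "{w. set w \<subseteq> S \<and> length w = 0} = {[]}"
    by auto
  then show ?case
    by simp
next
  case (Suc n)
  let ?W = "{w. set w \<subseteq> S \<and> length w = n}"
  let ?\<beta> = "\<lambda>w. sum_list (map \<alpha> w)"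
  have "(\<Sum>w | set w \<subseteq> S \<and> length w = Suc n. cos (?\<beta> w)) = (\<Sum>(w, a)\<in>?W \<times> S. cos (\<alpha> a + ?\<beta> w))"
    unfolding lists_length_Suc_eq
    by (subst sum.reindex) (auto simp: inj_on_def case_prod_unfold)
  also have "\<dots> = (\<Sum>w\<in>?W. \<Sum>a\<in>S. cos (?\<beta> w) * cos (\<alpha> a) - sin (?\<beta> w) * sin (\<alpha> a))"
    by (simp add: sum.cartesian_product cos_add mult.commute)
  also have "\<dots> = (\<Sum>w\<in>?W. cos (?\<beta> w)) * (\<Sum>a\<in>S. cos (\<alpha> a))"
    using assms(2) by (simp add: sum_subtractf sum_distrib_left[symmetric] sum_distrib_right)
  finally show ?case
    using Suc by simp
qed

lemma sum_words_cos:
  "(\<Sum>w\<in>words n (2 * m + 1).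
      cos (real_of_int (sum_list (map coord1 w)) * x + real_of_int (sum_list (map coord2 w)) * y))
    = ((2 * real m + 1) * charf m x y) ^ n"
proof -
  let ?\<alpha> = "\<lambda>a. real_of_int (coord1 a) * x + real_of_int (coord2 a) * y"
  \<comment> \<open>Oddness holds because the argument is even; on odd numbers \<open>div\<close>
    would round the two signs differently.\<close>
  have [simp]: "coord1 (- (2 * int k)) = - coord1 (2 * int k)"
      "coord2 (- (2 * int k)) = - coord2 (2 * int k)" for k
    by (simp_all add: coord1_def coord2_def)
  have val: "coord1 (2 * int k) = 2 - int k" "coord2 (2 * int k) = int k - 1" if "k \<ge> 1" for k
    using that by (simp_all add: coord1_def coord2_def)
  have minus: "?\<alpha> (- (2 * int k)) = - ?\<alpha> (2 * int k)" for k
    by simp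
  have sin0: "(\<Sum>a\<in>alphabet (2 * m + 1). sin (?\<alpha> a)) = 0"
    unfolding sum_alphabet_odd minus sin_minus add.right_inverse by (simp add: coord1_def coord2_def)
  have cos1: "(\<Sum>a\<in>alphabet (2 * m + 1). cos (?\<alpha> a)) = (2 * real m + 1) * charf m x y"
  proof -
    have "(\<Sum>a\<in>alphabet (2 * m + 1). cos (?\<alpha> a)) = 1 + (\<Sum>k=1..m. 2 * cos (?\<alpha> (2 * int k)))"
      unfolding sum_alphabet_odd minus cos_minus mult_2[symmetric] by (simp add: coord1_def coord2_def)
    also have "\<dots> = 1 + 2 * (\<Sum>k=1..m. cos ((2 - real k) * x + (real k - 1) * y))"
      by (simp add: sum_distrib_left val)
    finally show ?thesis
      by (simp add: charf_def)
  qed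
  have lin: "real_of_int (sum_list (map coord1 w)) * x + real_of_int (sum_list (map coord2 w)) * y
      = sum_list (map ?\<alpha> w)" for w
    by (induction w) (simp_all add: algebra_simps)
  show ?thesis
    unfolding lin words_eq by (simp only: sum_lists_cos[OF finite_alphabet sin0] cos1)
qed

lemma sum_list_sgn:
  "sum_list (map sgn x) =
    int (card {i. i < length x \<and> x ! i > 0}) - int (card {i. i < length x \<and> x ! i < (0::int)})"
proof -
  have "sum_list (map sgn x) = (\<Sum>i<length x. sgn (x ! i))"
    by (simp add: sum_list_sum_nth atLeast0LessThan)
  also have "\<dots> = (\<Sum>i<length x. of_bool (x ! i > 0) - of_bool (x ! i < 0))"
    by (intro sum.cong) (auto simp: sgn_if)
  also have "\<dots> = int (card ({..<length x} \<inter> {i. x ! i > 0})) - int (card ({..<length x} \<inter> {i. x ! i < 0}))"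
    by (simp add: sum_subtractf)
  also have "{..<length x} \<inter> {i. x ! i > 0} = {i. i < length x \<and> x ! i > 0}"
    by auto
  also have "{..<length x} \<inter> {i. x ! i < 0} = {i. i < length x \<and> x ! i < 0}"
    by auto
  finally show ?thesis .
qed

text \<open>If \<open>u\<close> and \<open>v\<close> are the two coordinate sums, half the charge is
  \<open>u + 2 * v\<close> and the polarity is \<open>u + v\<close>. This system has determinant -1,
  so both vanish exactly when \<open>u = v = 0\<close>.\<close>

lemma CPB_iff_coords:
  assumes "w \<in> words n (2 * m + 1)"
  shows "CPB w \<longleftrightarrow> sum_list (map coord1 w) = 0 \<and> sum_list (map coord2 w) = 0"
proof -
  have ev: "\<forall>a\<in>set w. even a"
    using assms alphabet_odd_bounds(1) by (auto simp: words_def)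
  have "(\<Sum>i<length w. w ! i) = sum_list w"
    by (simp add: sum_list_sum_nth atLeast0LessThan)
  also have "\<dots> = 2 * (sum_list (map coord1 w) + 2 * sum_list (map coord2 w))"
    using ev by (induction w) (auto simp: coord1_def coord2_def)
  finally have "(\<Sum>i<length w. w ! i) = 2 * (sum_list (map coord1 w) + 2 * sum_list (map coord2 w))" .
  then have "charge_balanced w \<longleftrightarrow> sum_list (map coord1 w) + 2 * sum_list (map coord2 w) = 0"
    by (simp only: charge_balanced_def mult_eq_0_iff zero_neq_numeral[symmetric] simp_thms)
  moreover have "sum_list (map sgn w) = sum_list (map coord1 w) + sum_list (map coord2 w)"
    by (induction w) (auto simp: coord1_def coord2_def)
  then have "polarity_balanced w \<longleftrightarrow> sum_list (map coord1 w) + sum_list (map coord2 w) = 0"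
    unfolding polarity_balanced_def using sum_list_sgn[of w] by linarith
  ultimately show ?thesis
    unfolding CPB_def by auto
qed

section \<open>Fourier inversion and decay of the characteristic function\<close>

text \<open>The power of \<open>charf\<close> expands into a sum of cosines over all words; by
  orthogonality each CPB word contributes the area \<open>(2 * pi * r)\<^sup>2\<close> and every
  other word 0.\<close>

lemma M_CPB_fourier:
  fixes r :: real
  assumes "r > 0"
  shows "(\<integral>(x, y). charf m (x / r) (y / r) ^ n
        * (indicator {- pi * r..pi * r} x * indicator {- pi * r..pi * r} y) \<partial>(lborel \<Otimes>\<^sub>M lborel))
    = (2 * pi * r)\<^sup>2 * real (M_CPB n (2 * m + 1)) / (2 * real m + 1) ^ n"
proof -
  let ?I = "indicator {- pi * r..pi * r} :: real \<Rightarrow> real"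
  let ?W = "words n (2 * m + 1)"
  let ?u = "\<lambda>w. sum_list (map coord1 w)" and ?v = "\<lambda>w. sum_list (map coord2 w)"
  have "has_bochner_integral (lborel \<Otimes>\<^sub>M lborel)
    (\<lambda>p. \<Sum>w\<in>?W. (case p of (x, y) \<Rightarrow>
        cos (real_of_int (?u w) * (x / r) + real_of_int (?v w) * (y / r)) * (?I x * ?I y)))
    (\<Sum>w\<in>?W. if ?u w = 0 \<and> ?v w = 0 then (2 * pi * r)\<^sup>2 else 0)"
    by (intro has_bochner_integral_sum cos_lattice_orthogonality assms)
  also have "(\<lambda>p. \<Sum>w\<in>?W. (case p of (x, y) \<Rightarrow>
        cos (real_of_int (?u w) * (x / r) + real_of_int (?v w) * (y / r)) * (?I x * ?I y)))
      = (\<lambda>p. (2 * real m + 1) ^ n * (case p of (x, y) \<Rightarrow> charf m (x / r) (y / r) ^ n * (?I x * ?I y)))"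
    by (simp only: case_prod_unfold sum_distrib_right[symmetric] sum_words_cos power_mult_distrib mult.assoc)
  also have "(\<Sum>w\<in>?W. if ?u w = 0 \<and> ?v w = 0 then (2 * pi * r)\<^sup>2 else 0)
      = (\<Sum>w | w \<in> ?W \<and> CPB w. (2 * pi * r)\<^sup>2)"
    by (subst sum.inter_filter[OF finite_words]) (auto intro!: sum.cong simp: CPB_iff_coords)
  also have "\<dots> = (2 * pi * r)\<^sup>2 * real (M_CPB n (2 * m + 1))"
    by (simp add: M_CPB_def)
  finally have "(2 * real m + 1) ^ n * (\<integral>(x, y). charf m (x / r) (y / r) ^ n * (?I x * ?I y) \<partial>(lborel \<Otimes>\<^sub>M lborel))
     = (2 * pi * r)\<^sup>2 * real (M_CPB n (2 * m + 1))"
    by (simp add: has_bochner_integral_iff)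
  then show ?thesis
    by (simp add: field_simps)
qed

text \<open>The letters \<plusminus>2 and \<plusminus>4, present since \<open>m \<ge> 2\<close>,
  contribute \<open>2 * (cos x + cos y)\<close>, which falls short of 4 by at least
  \<open>(x\<^sup>2 + y\<^sup>2) / 9\<close>. The remaining cosines are bounded trivially.\<close>

lemma charf_abs_le:
  assumes "m \<ge> 2" and "\<bar>x\<bar> \<le> pi" and "\<bar>y\<bar> \<le> pi"
  shows "\<bar>charf m x y\<bar> \<le> exp (- (x\<^sup>2 + y\<^sup>2) / (16 * (2 * real m + 1)))"
proof -
  define q where "q = 2 * real m + 1"
  have q: "q > 0"
    by (simp add: q_def)
  let ?c = "\<lambda>k. cos ((2 - real k) * x + (real k - 1) * y)"
  define R where "R = (\<Sum>k=3..m. ?c k)"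
  have "{1..m} = insert 1 (insert 2 {3..m})"
    using assms(1) by auto
  then have charf: "q * charf m x y = 1 + 2 * (cos x + cos y + R)"
    using q by (simp add: charf_def q_def R_def)
  have "\<bar>R\<bar> \<le> (\<Sum>k=3..m. 1)"
    unfolding R_def by (rule order_trans[OF sum_abs sum_mono]) simp
  then have R: "\<bar>R\<bar> \<le> real m - 2"
    using assms(1) by (simp add: of_nat_diff)
  have sq: "x\<^sup>2 \<le> 16" "y\<^sup>2 \<le> 16"
    using abs_le_square_iff[of x 4] abs_le_square_iff[of y 4] assms(2,3) pi_less_4 by auto
  have "q * charf m x y \<le> q - (x\<^sup>2 + y\<^sup>2) / 16"
    using charf R one_minus_cos_ge[OF assms(2)] one_minus_cos_ge[OF assms(3)] zero_le_power2[of x] zero_le_power2[of y]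
    unfolding q_def by argo
  \<comment> \<open>The letter 0 keeps \<open>q * charf m x y\<close> at least \<open>2 - q\<close>.
    The gap of 2 absorbs \<open>(x\<^sup>2 + y\<^sup>2) / 16\<close> because
    \<open>x\<^sup>2 + y\<^sup>2 \<le> 32\<close>; this fixes the constant 16.\<close>
  moreover have "- (q * charf m x y) \<le> q - (x\<^sup>2 + y\<^sup>2) / 16"
    unfolding charf unfolding q_def
    using R sq cos_ge_minus_one[of x] cos_ge_minus_one[of y] by (simp only: abs_le_iff) argo
  ultimately have "\<bar>q * charf m x y\<bar> \<le> q - (x\<^sup>2 + y\<^sup>2) / 16"
    by simp
  then have "\<bar>charf m x y\<bar> \<le> 1 + (- (x\<^sup>2 + y\<^sup>2) / (16 * q))"
    using q by (simp add: abs_mult field_simps)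
  also have "\<dots> \<le> exp (- (x\<^sup>2 + y\<^sup>2) / (16 * q))"
    by (rule exp_ge_add_one_self)
  finally show ?thesis
    by (simp add: q_def)
qed

section \<open>Covariance of one step and the pointwise Gaussian limit\<close>

text \<open>With the next two definitions, the covariance matrix of (\<open>coord1\<close>,
  \<open>coord2\<close>) for a uniform letter. The mean is 0 by symmetry, so second moments suffice;
  the factor 2 counts the letters \<plusminus>2k.\<close>

definition covar11 :: "nat \<Rightarrow> real" where
  "covar11 m = 2 * (\<Sum>k=1..m. (2 - real k)\<^sup>2) / (2 * real m + 1)"

definition covar12 :: "nat \<Rightarrow> real" where
  "covar12 m = 2 * (\<Sum>k=1..m. (2 - real k) * (real k - 1)) / (2 * real m + 1)"

definition covar22 :: "nat \<Rightarrow> real" where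
  "covar22 m = 2 * (\<Sum>k=1..m. (real k - 1)\<^sup>2) / (2 * real m + 1)"

lemma covar_quadratic_form:
  "covar11 m * x\<^sup>2 + 2 * covar12 m * x * y + covar22 m * y\<^sup>2
    = 2 * (\<Sum>k=1..m. ((2 - real k) * x + (real k - 1) * y)\<^sup>2) / (2 * real m + 1)"
proof -
  have "(\<Sum>k=1..m. ((2 - real k) * x + (real k - 1) * y)\<^sup>2)
    = (\<Sum>k=1..m. (2 - real k)\<^sup>2) * x\<^sup>2 + 2 * (\<Sum>k=1..m. (2 - real k) * (real k - 1)) * x * y
      + (\<Sum>k=1..m. (real k - 1)\<^sup>2) * y\<^sup>2"
    unfolding sum_distrib_left sum_distrib_right sum.distrib[symmetric]
    by (intro sum.cong) (auto simp: power2_eq_square algebra_simps)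
  then show ?thesis
    unfolding covar11_def covar12_def covar22_def
    by (simp add: add_divide_distrib[symmetric] algebra_simps)
qed

text \<open>Each cosine in \<open>charf\<close> has second-order expansion with quadratic term
  \<open>- (?t k)\<^sup>2 / 2\<close>, so \<open>n\<close> times \<open>charf - 1\<close> tends to
  minus half the variance of the linear form; \<open>tendsto_power_exp\<close> then applies.\<close>

lemma charf_power_tendsto:
  "(\<lambda>n. charf m (x / sqrt (real n)) (y / sqrt (real n)) ^ n)
    \<longlonglongrightarrow> exp (- (covar11 m * x\<^sup>2 + 2 * covar12 m * x * y + covar22 m * y\<^sup>2) / 2)"
proof -
  let ?t = "\<lambda>k. (2 - real k) * x + (real k - 1) * y"
  define w where "w n = 2 * (\<Sum>k=1..m. cos (?t k / sqrt (real n)) - 1) / (2 * real m + 1)" for n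
  have charf: "charf m (x / sqrt (real n)) (y / sqrt (real n)) = 1 + w n" for n
    by (simp add: charf_def w_def sum_subtractf add_divide_distrib[symmetric] field_simps)
  have "(\<lambda>n. 2 * (\<Sum>k=1..m. real n * (cos (?t k / sqrt (real n)) - 1)) / (2 * real m + 1))
      \<longlonglongrightarrow> 2 * (\<Sum>k=1..m. - (?t k)\<^sup>2 / 2) / (2 * real m + 1)"
    by (intro tendsto_intros cos_second_order) auto
  also have "(\<lambda>n. 2 * (\<Sum>k=1..m. real n * (cos (?t k / sqrt (real n)) - 1)) / (2 * real m + 1)) = (\<lambda>n. real n * w n)"
    unfolding w_def by (simp add: sum_distrib_left mult_ac)
  also have "2 * (\<Sum>k=1..m. - (?t k)\<^sup>2 / 2) / (2 * real m + 1)
      = - (covar11 m * x\<^sup>2 + 2 * covar12 m * x * y + covar22 m * y\<^sup>2) / 2"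
  proof -
    have "2 * (- S / 2) / D = - (2 * S / D) / 2" for S D :: real
      by simp
    then show ?thesis
      unfolding covar_quadratic_form sum_divide_distrib[symmetric] sum_negf .
  qed
  finally show ?thesis
    unfolding charf by (rule tendsto_power_exp)
qed

lemma sum_covar_closed_forms:
  "(\<Sum>k=1..m. (2 - real k)\<^sup>2) = real m * (2 * (real m)\<^sup>2 - 9 * real m + 13) / 6"
  "(\<Sum>k=1..m. (2 - real k) * (real k - 1)) = - real m * (real m - 1) * (real m - 2) / 3"
  "(\<Sum>k=1..m. (real k - 1)\<^sup>2) = real m * (real m - 1) * (2 * real m - 1) / 6"
  by (induction m) (auto simp: field_simps power2_eq_square)

lemma covar_det:
  assumes "q = 2 * m + 1"
  shows "covar11 m * covar22 m - (covar12 m)\<^sup>2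
    = (real q ^ 2 - 1) * (real q - 1) * (real q - 3) / (48 * real q ^ 2)"
proof -
  have q: "real q = 2 * real m + 1" "2 * real m + 1 \<noteq> 0"
    using assms by auto
  show ?thesis
    unfolding covar11_def covar12_def covar22_def sum_covar_closed_forms q(1)
    using q(2) by (simp add: divide_simps) (simp add: power2_eq_square algebra_simps)
qed

lemma covar11_pos:
  assumes "m \<ge> 1"
  shows "covar11 m > 0"
proof -
  have "(\<Sum>k=1..m. (2 - real k)\<^sup>2) > 0"
    using assms by (intro sum_pos2[of _ 1]) auto
  then show ?thesis
    by (simp add: covar11_def)
qed

section \<open>The local limit theorem\<close>

lemma M_CPB_asymptotics:
  assumes "m \<ge> 2"
  shows "(\<lambda>n. real n * real (M_CPB n (2 * m + 1)) / (2 * real m + 1) ^ n)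
    \<longlonglongrightarrow> 1 / (2 * pi * sqrt (covar11 m * covar22 m - (covar12 m)\<^sup>2))"
proof -
  \<comment> \<open>Chosen so that \<open>c / 2\<close> is the rate in \<open>charf_abs_le\<close>.
    The \<open>n\<close>-th power cancels the rescaling by \<open>sqrt n\<close>, so the majorant
    \<open>w\<close> is free of \<open>n\<close>.\<close>
  define c where "c = 1 / (8 * (2 * real m + 1))"
  define s where "s n p = (case p of (x, y) \<Rightarrow> charf m (x / sqrt (real n)) (y / sqrt (real n)) ^ n
        * (indicator {- pi * sqrt (real n)..pi * sqrt (real n)} x
          * indicator {- pi * sqrt (real n)..pi * sqrt (real n)} y))" for n and p :: "real \<times> real"
  define g where "g = (\<lambda>(x, y).
      exp (- (covar11 m * x\<^sup>2 + 2 * covar12 m * x * y + covar22 m * y\<^sup>2) / 2))"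
  define w where "w p = (case p of (x, y) \<Rightarrow>
      exp (- c * (x + 0)\<^sup>2 / 2) * exp (- c * (y + 0)\<^sup>2 / 2))" for p :: "real \<times> real"
  have c: "c > 0"
    by (simp add: c_def)
  have s_le: "norm (s n p) \<le> w p" for n p
  proof (cases "\<bar>fst p\<bar> \<le> pi * sqrt (real n) \<and> \<bar>snd p\<bar> \<le> pi * sqrt (real n)")
    case outside: False
    then have "s n p = 0"
      by (auto simp: s_def case_prod_unfold indicator_def abs_le_iff)
    then show ?thesis
      by (simp add: w_def case_prod_unfold)
  next
    case inside: True
    obtain x y where p: "p = (x, y)"
      by (cases p)
    show ?thesis
    \<comment> \<open>For \<open>n = 0\<close> the square degenerates to the origin, where
      \<open>w\<close> equals 1.\<close>
    proof (cases "n = 0")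
      case True
      then show ?thesis
        using inside by (simp add: s_def w_def p)
    next
      case False
      then have n: "sqrt (real n) > 0"
        by simp
      have "\<bar>charf m (x / sqrt (real n)) (y / sqrt (real n))\<bar>
          \<le> exp (- ((x / sqrt (real n))\<^sup>2 + (y / sqrt (real n))\<^sup>2) / (16 * (2 * real m + 1)))"
        using inside n by (intro charf_abs_le assms) (auto simp: p divide_le_eq)
      then have "\<bar>charf m (x / sqrt (real n)) (y / sqrt (real n))\<bar> ^ n
          \<le> exp (- ((x / sqrt (real n))\<^sup>2 + (y / sqrt (real n))\<^sup>2) / (16 * (2 * real m + 1))) ^ n"
        by (intro power_mono) auto
      also have "\<dots> = w p"
      proof -
        have "real n * (- (x\<^sup>2 / real n + y\<^sup>2 / real n) / (16 * D))
            = - (1 / (8 * D)) * (x + 0)\<^sup>2 / 2 + - (1 / (8 * D)) * (y + 0)\<^sup>2 / 2" if "D > 0" for D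
          using False that by (simp add: field_simps)
        from this[of "2 * real m + 1"] show ?thesis
          unfolding exp_of_nat_mult[symmetric] w_def p c_def prod.case exp_add[symmetric] power_divide
          by simp
      qed
      finally have "\<bar>charf m (x / sqrt (real n)) (y / sqrt (real n))\<bar> ^ n \<le> w p" .
      moreover have "norm (s n p) \<le> \<bar>charf m (x / sqrt (real n)) (y / sqrt (real n))\<bar> ^ n"
        by (simp add: s_def p abs_mult power_abs indicator_def)
      ultimately show ?thesis
        by simp
    qed
  qed
  have s_lim: "(\<lambda>n. s n p) \<longlonglongrightarrow> g p" for p
  proof -
    obtain x y where p: "p = (x, y)"
      by (cases p)
    \<comment> \<open>A fixed point eventually lies in the growing square, so the indicators become
      1.\<close>
    have "\<forall>\<^sub>F n in sequentially. \<bar>x\<bar> \<le> pi * sqrt (real n)" "\<forall>\<^sub>F n in sequentially. \<bar>y\<bar> \<le> pi * sqrt (real n)"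
      by real_asymp+
    then have "\<forall>\<^sub>F n in sequentially. charf m (x / sqrt (real n)) (y / sqrt (real n)) ^ n = s n p"
      by eventually_elim (auto simp: s_def p indicator_def abs_le_iff)
    with charf_power_tendsto[of m x y] show ?thesis
      unfolding g_def p prod.case by (rule Lim_transform_eventually)
  qed
  have s_meas: "s n \<in> borel_measurable (lborel \<Otimes>\<^sub>M lborel)" for n
    unfolding s_def charf_def by measurable
  have g_meas: "g \<in> borel_measurable (lborel \<Otimes>\<^sub>M lborel)"
    unfolding g_def by measurable
  have w_int: "integrable (lborel \<Otimes>\<^sub>M lborel) w"
    unfolding w_def by (intro integrable_pair_mult gaussian_integral_1d c)
  have g_int: "integrable (lborel \<Otimes>\<^sub>M lborel) g"
    by (rule integrable_dominated_convergence[where s = s and w = w])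
       (use s_le s_lim s_meas g_meas w_int in auto)
  have "(\<lambda>n. integral\<^sup>L (lborel \<Otimes>\<^sub>M lborel) (s n)) \<longlonglongrightarrow> integral\<^sup>L (lborel \<Otimes>\<^sub>M lborel) g"
    by (rule integral_dominated_convergence[where w = w])
       (use s_le s_lim s_meas g_meas w_int in auto)
  moreover have "integral\<^sup>L (lborel \<Otimes>\<^sub>M lborel) g = 2 * pi / sqrt (covar11 m * covar22 m - (covar12 m)\<^sup>2)"
    unfolding g_def
  proof (rule gaussian_integral_2d)
    show "covar11 m > 0"
      using assms by (intro covar11_pos) simp
    have "real m > 1"
      using assms by simp
    then have "0 < (real (2 * m + 1) ^ 2 - 1) * (real (2 * m + 1) - 1) * (real (2 * m + 1) - 3) / (48 * real (2 * m + 1) ^ 2)"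
      by (intro divide_pos_pos mult_pos_pos) auto
    then show "covar11 m * covar22 m - (covar12 m)\<^sup>2 > 0"
      by (simp only: covar_det[OF refl])
  qed (use g_int in \<open>simp only: g_def\<close>)
  ultimately have "(\<lambda>n. integral\<^sup>L (lborel \<Otimes>\<^sub>M lborel) (s n) / (2 * pi)\<^sup>2)
      \<longlonglongrightarrow> 2 * pi / sqrt (covar11 m * covar22 m - (covar12 m)\<^sup>2) / (2 * pi)\<^sup>2"
    by (intro tendsto_divide tendsto_const) auto
  also have "2 * pi / sqrt (covar11 m * covar22 m - (covar12 m)\<^sup>2) / (2 * pi)\<^sup>2
      = 1 / (2 * pi * sqrt (covar11 m * covar22 m - (covar12 m)\<^sup>2))"
    by (simp add: power2_eq_square)
  finally show ?thesis
  proof (rule Lim_transform_eventually)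
    show "\<forall>\<^sub>F n in sequentially. integral\<^sup>L (lborel \<Otimes>\<^sub>M lborel) (s n) / (2 * pi)\<^sup>2
        = real n * real (M_CPB n (2 * m + 1)) / (2 * real m + 1) ^ n"
      using eventually_gt_at_top[of 0]
    proof eventually_elim
      case (elim n)
      then have "integral\<^sup>L (lborel \<Otimes>\<^sub>M lborel) (s n)
          = (2 * pi * sqrt (real n))\<^sup>2 * real (M_CPB n (2 * m + 1)) / (2 * real m + 1) ^ n"
        unfolding s_def by (intro M_CPB_fourier) simp
      then show ?case
        by (simp add: power_mult_distrib)
    qed
  qed
qed

section \<open>From counting CPB words to redundancy\<close>

lemma replicate_zero_CPB:
  assumes "odd q"
  shows "replicate n 0 \<in> {x \<in> words n q. CPB x}"
proof -
  obtain m where m: "q = 2 * m + 1"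
    using assms by (rule oddE)
  then have "0 \<in> alphabet q"
    by (auto simp: alphabet_def image_iff intro!: bexI[of _ m])
  then show ?thesis
    by (auto simp: words_def CPB_def charge_balanced_def polarity_balanced_def cong: conj_cong)
qed

lemma M_CPB_pos:
  assumes "odd q"
  shows "M_CPB n q > 0"
  unfolding M_CPB_def using replicate_zero_CPB[OF assms] by (subst card_gt_0_iff) auto

text \<open>Redundancy decreases with the size of a nonempty code, so the set of all CPB words is
  optimal; the zero word makes it nonempty.\<close>

lemma r_CPB_eq:
  assumes "q \<ge> 2" and "odd q"
  shows "r_CPB n q = real n - log (real q) (real (M_CPB n q))"
  unfolding r_CPB_def
proof (rule Min_eqI)
  let ?X = "{x \<in> words n q. CPB x}"
  have codes: "{C. is_CPB_code n q C \<and> C \<noteq> {}} = Pow ?X - {{}}"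
    by (auto simp: is_CPB_code_def)
  show "finite (redundancy n q ` {C. is_CPB_code n q C \<and> C \<noteq> {}})"
    unfolding codes by simp
  show "real n - log (real q) (real (M_CPB n q)) \<in> redundancy n q ` {C. is_CPB_code n q C \<and> C \<noteq> {}}"
    unfolding codes
    by (rule image_eqI[of _ _ ?X]) (use replicate_zero_CPB[OF assms(2)] in \<open>auto simp: redundancy_def M_CPB_def\<close>)
  fix r assume "r \<in> redundancy n q ` {C. is_CPB_code n q C \<and> C \<noteq> {}}"
  then obtain C where C: "C \<subseteq> ?X" "C \<noteq> {}" and r: "r = redundancy n q C"
    unfolding codes by auto
  have fin: "finite ?X"
    by simp
  have "card C > 0"
    using C finite_subset[OF C(1) fin] by (simp add: card_gt_0_iff)
  moreover have "card C \<le> M_CPB n q"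
    unfolding M_CPB_def using C(1) fin by (rule card_mono[rotated])
  ultimately have "log (real q) (real (card C)) \<le> log (real q) (real (M_CPB n q))"
    using assms(1) by (intro log_mono) auto
  then show "real n - log (real q) (real (M_CPB n q)) \<le> r"
    by (simp add: r redundancy_def)
qed

theorem corollary12:
  fixes q :: nat
  assumes "q \<ge> 5" and "odd q"
  shows "(\<forall>n::nat. n \<ge> 1 \<longrightarrow>
            r_CPB n q = real n - log (real q) (real (M_CPB n q))) \<and>
         (\<lambda>n::nat. r_CPB n q -
            (log (real q) (real n) +
             log (real q) (pi * sqrt ((real q ^ 2 - 1) * (real q - 1) * (real q - 3)
                                      / (12 * real q ^ 2))))) \<longlonglongrightarrow> 0"
proof -
  obtain m where m: "q = 2 * m + 1"
    using assms(2) by (rule oddE)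
  have m2: "m \<ge> 2" and q: "real q > 1" and qm: "real q = 2 * real m + 1"
    using assms(1) m by auto
  have r: "r_CPB n q = real n - log (real q) (real (M_CPB n q))" for n
    using assms by (intro r_CPB_eq) auto
  define K where "K = pi * sqrt ((real q ^ 2 - 1) * (real q - 1) * (real q - 3) / (12 * real q ^ 2))"
  have "real q ^ 2 > 1"
    using q by (simp add: one_less_power)
  then have K: "K > 0"
    unfolding K_def using assms(1) by (intro mult_pos_pos real_sqrt_gt_zero divide_pos_pos) auto
  \<comment> \<open>The factor 4 between the denominators 12 and 48 leaves the root as 2, turning
    \<open>K\<close> into the constant of the local limit theorem.\<close>
  have "(real q ^ 2 - 1) * (real q - 1) * (real q - 3) / (12 * real q ^ 2)
      = 2\<^sup>2 * (covar11 m * covar22 m - (covar12 m)\<^sup>2)"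
    unfolding covar_det[OF m] by simp
  then have K_eq: "K = 2 * pi * sqrt (covar11 m * covar22 m - (covar12 m)\<^sup>2)"
    by (simp only: K_def real_sqrt_mult real_sqrt_abs abs_numeral mult_ac)
  have "(\<lambda>n. real n * real (M_CPB n q) / real q ^ n) \<longlonglongrightarrow> 1 / K"
    using M_CPB_asymptotics[OF m2, folded m qm] unfolding K_eq .
  \<comment> \<open>Normalised to limit 1, this quantity has minus its logarithm to base
    \<open>q\<close> equal to the difference in the claim for every \<open>n > 0\<close>.\<close>
  then have "(\<lambda>n. real n * real (M_CPB n q) / real q ^ n * K) \<longlonglongrightarrow> 1 / K * K"
    by (rule tendsto_mult_right)
  then have "(\<lambda>n. - log (real q) (real n * real (M_CPB n q) / real q ^ n * K)) \<longlonglongrightarrow> - log (real q) (1 / K * K)"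
    using K q by (intro tendsto_minus tendsto_log tendsto_const) auto
  then have "(\<lambda>n. - log (real q) (real n * real (M_CPB n q) / real q ^ n * K)) \<longlonglongrightarrow> 0"
    using K by simp
  then have "(\<lambda>n. r_CPB n q - (log (real q) (real n) + log (real q) K)) \<longlonglongrightarrow> 0"
  proof (rule Lim_transform_eventually)
    show "\<forall>\<^sub>F n in sequentially. - log (real q) (real n * real (M_CPB n q) / real q ^ n * K)
        = r_CPB n q - (log (real q) (real n) + log (real q) K)"
      using eventually_gt_at_top[of 0]
    proof eventually_elim
      case (elim n)
      then show ?case
        unfolding r using K q M_CPB_pos[OF assms(2), of n]
        by (simp add: log_mult log_divide log_nat_power)
    qed
  qed
  then show ?thesis
    using r by (auto simp: K_def)
qed

end
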